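(* For integers $n, m \geq 0$, let $cp_{1-2}(n, m)$ denote the number of partitions of $n$ into $m$ parts $\lambda_1 \leq \cdots \leq \lambda_m$ such that $\lambda_{i+1} - \lambda_i \geq 2$ for all $i$, and $\lambda_{i+1} - \lambda_i \geq 4$ unless $\lambda_i + \lambda_{i+1} \equiv 2 \pmod{3}$. Then \[ \sum_{m, n \geq 0} cp_{1-2}(n,m) q^n x^m = \sum_{n_1, n_2 \geq 0} \frac{ q^{6n_2^2 - n_2 + 2n_1^2 - n_1 + 6n_2 n_1} x^{2n_2 + n_1} }{ (q; q)_{n_1} (q^3; q^3)_{n_2} }. \]
   Context: A partition of $n$ into $m$ parts is a non-decreasing sequence of $m$ positive integers summing to $n$. For $n \geq 0$, $(a; q)_n = \prod_{j=1}^{n} (1 - a q^{j-1})$, with the empty product equal to $1$. *)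

theory Defs
  imports
    "HOL-Analysis.Infinite_Sum"
    "HOL-Computational_Algebra.Formal_Power_Series"
    "HOL-Number_Theory.Cong"
begin

definition qpochhammer :: "'a::comm_ring_1 \<Rightarrow> 'a \<Rightarrow> nat \<Rightarrow> 'a" where
  "qpochhammer a q n = (\<Prod>j=1..n. 1 - a * q ^ (j - 1))"

definition partition_into :: "nat \<Rightarrow> nat \<Rightarrow> nat list \<Rightarrow> bool" where
  "partition_into n m l \<longleftrightarrow>
     length l = m \<and> sorted l \<and> (\<forall>a\<in>set l. 0 < a) \<and> sum_list l = n"

text \<open>The subtractions never truncate for a sorted list. Indices start at 0, so \<open>l ! i\<close>
  is \<open>\<lambda>\<^bsub>i+1\<^esub>\<close>.\<close>

definition cp12_condition :: "nat list \<Rightarrow> bool" where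
  "cp12_condition l \<longleftrightarrow>
     (\<forall>i. Suc i < length l \<longrightarrow>
        l ! Suc i - l ! i \<ge> 2 \<and>
        (\<not> [l ! i + l ! Suc i = 2] (mod 3) \<longrightarrow> l ! Suc i - l ! i \<ge> 4))"

definition cp12 :: "nat \<Rightarrow> nat \<Rightarrow> nat" where
  "cp12 n m = card {l. partition_into n m l \<and> cp12_condition l}"

text \<open>Bivariate series live in \<open>\<rat>[[q]][[x]]\<close>, the type \<^typ>\<open>rat fps fps\<close>: the inner variable is
  \<open>q\<close> and the outer one is \<open>x\<close>. The library topology on this type is the \<open>x\<close>-adic one.\<close>

abbreviation q_var :: "rat fps" where
  "q_var \<equiv> fps_X"

abbreviation x_var :: "rat fps fps" where
  "x_var \<equiv> fps_X"

end

theory Submission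
  imports Defs
begin

text \<open>
  Let \<open>S(i,j)\<close> be the double series with the extra factor \<open>q^(i n\<^sub>1 + j n\<^sub>2)\<close> in the summand.
  Cancelling the last factor of one of the two \<open>q\<close>-Pochhammer symbols gives
  \<open>S(i,j) = S(i+1,j) + x q^(i+1) S(i+4,j+6)\<close> and
  \<open>S(i,j) = S(i,j+3) + x\<^sup>2 q^(j+5) S(i+6,j+12)\<close>.
  On the other side, let \<open>G(k)\<close> be the generating function of the admissible partitions with all
  parts at least \<open>k\<close>. Removing the part \<open>k\<close>, if present, expresses \<open>G(k) - G(k+1)\<close> as
  \<open>x q^k G(k+3)\<close>, \<open>x q^k G(k+4)\<close> or \<open>x q^k G(k+4) + x\<^sup>2 q^(2k+2) G(k+6)\<close> for \<open>k\<close> congruent to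
  1, 2 or 0 modulo 3. These recurrences determine \<open>G\<close>, and by the two relations above they are
  solved by \<open>G(3t+1) = S(3t,6t)\<close>, \<open>G(3t+2) = S(3t+1,6t+3)\<close>, \<open>G(3t+3) = S(3t+2,6t+3)\<close>.
  The theorem is the case \<open>k = 1\<close>.
\<close>

unbundle fps_syntax

section \<open>The exponent, the \<open>q\<close>-Pochhammer symbols and the summand\<close>

definition qexp :: "nat \<Rightarrow> nat \<Rightarrow> nat" where
  "qexp a b = 6 * b\<^sup>2 - b + 2 * a\<^sup>2 - a + 6 * b * a"

lemma qexp_Suc_left: "qexp (Suc a) b = qexp a b + 4 * a + 6 * b + 1"
proof -
  have "2 * (Suc a)\<^sup>2 = 2 * a\<^sup>2 + 4 * a + 2" "6 * b * Suc a = 6 * b * a + 6 * b"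
    by (simp_all add: power2_eq_square)
  \<comment> \<open>These bounds show that neither subtraction in \<open>qexp\<close> truncates, so
    the quadratic form may be treated as over the integers.\<close>
  moreover have "a \<le> 2 * a\<^sup>2" "b \<le> 6 * b\<^sup>2"
    unfolding power2_eq_square by (cases a; simp) (cases b; simp)
  ultimately show ?thesis
    unfolding qexp_def by linarith
qed

lemma qexp_Suc_right: "qexp a (Suc b) = qexp a b + 12 * b + 6 * a + 5"
proof -
  have "6 * (Suc b)\<^sup>2 = 6 * b\<^sup>2 + 12 * b + 6" "6 * Suc b * a = 6 * b * a + 6 * a"
    by (simp_all add: power2_eq_square algebra_simps)
  moreover have "a \<le> 2 * a\<^sup>2" "b \<le> 6 * b\<^sup>2"
    unfolding power2_eq_square by (cases a; simp) (cases b; simp)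
  ultimately show ?thesis
    unfolding qexp_def by linarith
qed

text \<open>Raising \<open>a\<close> adds at least 1 to the exponent and raising \<open>b\<close> at
  least 5. This linear bound later makes low \<open>q\<close>-coefficients vanish.\<close>

lemma qexp_ge: "a + 5 * b \<le> qexp a b"
proof (induction a)
  case 0
  show ?case
    by (induction b) (simp_all add: qexp_Suc_right)
qed (simp add: qexp_Suc_left)

lemma qpochhammer_Suc: "qpochhammer a q (Suc n) = qpochhammer a q n * (1 - a * q ^ n)"
  by (simp add: qpochhammer_def)

lemma qpochhammer_fps_nth_0:
  fixes a q :: "'a::comm_ring_1 fps"
  assumes "a $ 0 = 0"
  shows "qpochhammer a q n $ 0 = 1"
  by (induction n) (simp_all add: qpochhammer_Suc assms, simp add: qpochhammer_def)

text \<open>The factor cancelled is the last one of the symbol. It is a unit, since \<open>a\<close>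
  has constant term 0.\<close>

lemma inverse_qpochhammer_Suc:
  fixes a q :: "'a::field fps"
  assumes "a $ 0 = 0"
  shows "(1 - a * q ^ n) * inverse (qpochhammer a q (Suc n)) = inverse (qpochhammer a q n)"
proof -
  have "(1 - a * q ^ n) * inverse (1 - a * q ^ n) = 1"
    by (rule inverse_mult_eq_1') (simp add: assms)
  then show ?thesis
    by (simp add: qpochhammer_Suc fps_inverse_mult mult_ac)
qed

definition qterm :: "nat \<Rightarrow> nat \<Rightarrow> nat \<Rightarrow> nat \<Rightarrow> rat fps" where
  "qterm i j a b = q_var ^ (qexp a b + i * a + j * b) *
     inverse (qpochhammer q_var q_var a) * inverse (qpochhammer (q_var ^ 3) (q_var ^ 3) b)"

lemma qterm_0_left: "qterm (Suc i) j 0 b = qterm i j 0 b"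
  by (simp add: qterm_def)

lemma qterm_0_right: "qterm i (j + 3) a 0 = qterm i j a 0"
  by (simp add: qterm_def)

text \<open>Raising \<open>i\<close> by 1 multiplies the summand at \<open>Suc a\<close> by
  \<open>q^(a+1)\<close>, so the difference carries \<open>1 - q^(a+1)\<close>, the last factor of
  the first symbol. The exponent left over is regrouped by \<open>qexp_Suc_left\<close>: its
  increment \<open>4a + 6b + 1\<close> turns \<open>(i, j)\<close> into
  \<open>(i + 4, j + 6)\<close>.\<close>

lemma qterm_Suc_left:
  "qterm i j (Suc a) b = qterm (Suc i) j (Suc a) b + q_var ^ (i + 1) * qterm (i + 4) (j + 6) a b"
proof -
  let ?e = "qexp (Suc a) b + i * Suc a + j * b"
  let ?u = "inverse (qpochhammer q_var q_var (Suc a)) :: rat fps"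
  let ?v = "inverse (qpochhammer (q_var ^ 3) (q_var ^ 3) b) :: rat fps"
  have "qterm i j (Suc a) b - qterm (Suc i) j (Suc a) b
      = q_var ^ ?e * ((1 - q_var * q_var ^ a) * ?u) * ?v"
    by (simp add: qterm_def algebra_simps power_add)
  also have "\<dots> = q_var ^ ?e * inverse (qpochhammer q_var q_var a) * ?v"
    by (subst inverse_qpochhammer_Suc) simp_all
  also have "\<dots> = q_var ^ (i + 1) * qterm (i + 4) (j + 6) a b"
    by (simp add: qterm_def qexp_Suc_left algebra_simps flip: power_add)
  finally show ?thesis
    by (simp add: algebra_simps)
qed

text \<open>Here \<open>j\<close> rises by 3 because the last factor of the second symbol is
  \<open>1 - q^(3(b+1))\<close>.\<close>

lemma qterm_Suc_right:
  "qterm i j a (Suc b) = qterm i (j + 3) a (Suc b) + q_var ^ (j + 5) * qterm (i + 6) (j + 12) a b"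
proof -
  let ?e = "qexp a (Suc b) + i * a + j * Suc b"
  let ?u = "inverse (qpochhammer q_var q_var a) :: rat fps"
  let ?v = "inverse (qpochhammer (q_var ^ 3) (q_var ^ 3) (Suc b)) :: rat fps"
  have "qterm i j a (Suc b) - qterm i (j + 3) a (Suc b)
      = q_var ^ ?e * ?u * ((1 - q_var ^ 3 * (q_var ^ 3) ^ b) * ?v)"
    by (simp add: qterm_def algebra_simps flip: power_add power_mult)
  also have "\<dots> = q_var ^ ?e * ?u * inverse (qpochhammer (q_var ^ 3) (q_var ^ 3) b)"
    by (subst inverse_qpochhammer_Suc) simp_all
  also have "\<dots> = q_var ^ (j + 5) * qterm (i + 6) (j + 12) a b"
    by (simp add: qterm_def qexp_Suc_right algebra_simps flip: power_add)
  finally show ?thesis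
    by (simp add: algebra_simps)
qed

section \<open>The double series and its two shift relations\<close>

definition weight_pairs :: "nat \<Rightarrow> (nat \<times> nat) set" where
  "weight_pairs m = {(a, b). a + 2 * b = m}"

lemma finite_weight_pairs: "finite (weight_pairs m)"
  by (rule finite_subset[of _ "{..m} \<times> {..m}"]) (auto simp: weight_pairs_def)

text \<open>The pairs with positive first entry are the image of \<open>weight_pairs m\<close> under
  raising that entry; the remaining pairs contribute 0 by assumption. This is how a factor
  \<open>x\<close> arises.\<close>

lemma sum_weight_pairs_Suc_left:
  assumes "\<And>b. f (0, b) = (0 :: 'a::comm_monoid_add)"
  shows "(\<Sum>p\<in>weight_pairs (Suc m). f p) = (\<Sum>(a, b)\<in>weight_pairs m. f (Suc a, b))"
proof -
  have "(\<Sum>p\<in>weight_pairs (Suc m). f p) = (\<Sum>p\<in>(\<lambda>(a, b). (Suc a, b)) ` weight_pairs m. f p)"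
  proof (rule sum.mono_neutral_right[OF finite_weight_pairs])
    show "\<forall>p\<in>weight_pairs (Suc m) - (\<lambda>(a, b). (Suc a, b)) ` weight_pairs m. f p = 0"
    proof clarify
      fix a b assume *: "(a, b) \<in> weight_pairs (Suc m)"
        "(a, b) \<notin> (\<lambda>(a, b). (Suc a, b)) ` weight_pairs m"
      then have "a = 0"
        by (cases a) (force simp: weight_pairs_def image_iff)+
      then show "f (a, b) = 0"
        using assms by simp
    qed
  qed (auto simp: weight_pairs_def)
  also have "\<dots> = (\<Sum>(a, b)\<in>weight_pairs m. f (Suc a, b))"
    by (subst sum.reindex) (auto simp: inj_on_def case_prod_unfold)
  finally show ?thesis .
qed

lemma sum_weight_pairs_Suc_right:
  assumes "\<And>a. f (a, 0) = (0 :: 'a::comm_monoid_add)"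
  shows "(\<Sum>p\<in>weight_pairs (Suc (Suc m)). f p) = (\<Sum>(a, b)\<in>weight_pairs m. f (a, Suc b))"
proof -
  have "(\<Sum>p\<in>weight_pairs (Suc (Suc m)). f p)
      = (\<Sum>p\<in>(\<lambda>(a, b). (a, Suc b)) ` weight_pairs m. f p)"
  proof (rule sum.mono_neutral_right[OF finite_weight_pairs])
    show "\<forall>p\<in>weight_pairs (Suc (Suc m)) - (\<lambda>(a, b). (a, Suc b)) ` weight_pairs m. f p = 0"
    proof clarify
      fix a b assume *: "(a, b) \<in> weight_pairs (Suc (Suc m))"
        "(a, b) \<notin> (\<lambda>(a, b). (a, Suc b)) ` weight_pairs m"
      then have "b = 0"
        by (cases b) (force simp: weight_pairs_def image_iff)+
      then show "f (a, b) = 0"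
        using assms by simp
    qed
  qed (auto simp: weight_pairs_def)
  also have "\<dots> = (\<Sum>(a, b)\<in>weight_pairs m. f (a, Suc b))"
    by (subst sum.reindex) (auto simp: inj_on_def case_prod_unfold)
  finally show ?thesis .
qed

lemma weight_pairs_0: "weight_pairs 0 = {(0, 0)}"
  by (auto simp: weight_pairs_def)

lemma weight_pairs_1: "weight_pairs (Suc 0) = {(1, 0)}"
  unfolding weight_pairs_def by auto presburger+

text \<open>Collecting the summands by their power of \<open>x\<close> makes every coefficient a
  finite sum, which postpones convergence to the final theorem.\<close>

definition double_series :: "nat \<Rightarrow> nat \<Rightarrow> rat fps fps" where
  "double_series i j = Abs_fps (\<lambda>m. \<Sum>(a, b)\<in>weight_pairs m. qterm i j a b)"

lemma double_series_shift_left: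
  "double_series i j = double_series (i + 1) j
     + x_var * (fps_const (q_var ^ (i + 1)) * double_series (i + 4) (j + 6))"
proof (rule fps_ext)
  fix m
  show "double_series i j $ m = (double_series (i + 1) j
     + x_var * (fps_const (q_var ^ (i + 1)) * double_series (i + 4) (j + 6))) $ m"
  proof (cases m)
    case 0
    then show ?thesis
      by (simp add: double_series_def weight_pairs_0 qterm_0_left)
  next
    case (Suc k)
    \<comment> \<open>The summands with \<open>a = 0\<close> do not depend on \<open>i\<close>, so
      they cancel in the difference and the sum can be reindexed.\<close>
    have "(\<Sum>p\<in>weight_pairs (Suc k). case p of (a, b) \<Rightarrow> qterm i j a b - qterm (Suc i) j a b)
        = (\<Sum>(a, b)\<in>weight_pairs k. q_var ^ (i + 1) * qterm (i + 4) (j + 6) a b)"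
      by (subst sum_weight_pairs_Suc_left) (simp_all add: qterm_0_left qterm_Suc_left[of i])
    then show ?thesis
      by (simp add: Suc double_series_def case_prod_unfold sum_subtractf sum_distrib_left
          algebra_simps)
  qed
qed

lemma double_series_shift_right:
  "double_series i j = double_series i (j + 3)
     + x_var ^ 2 * (fps_const (q_var ^ (j + 5)) * double_series (i + 6) (j + 12))"
proof (rule fps_ext)
  fix m
  show "double_series i j $ m = (double_series i (j + 3)
     + x_var ^ 2 * (fps_const (q_var ^ (j + 5)) * double_series (i + 6) (j + 12))) $ m"
  \<comment> \<open>Below \<open>x^2\<close> only pairs with \<open>b = 0\<close> occur, and their
    summands do not depend on \<open>j\<close>.\<close>
  proof (cases "m < 2")
    case True
    then consider "m = 0" | "m = Suc 0"
      by linarith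
    then show ?thesis
      by cases (simp_all add: double_series_def weight_pairs_0 weight_pairs_1 qterm_0_right
          fps_X_power_mult_nth)
  next
    case False
    then obtain k where k: "m = Suc (Suc k)"
      by (metis One_nat_def Suc_1 less_2_cases_iff not0_implies_Suc)
    have "(\<Sum>p\<in>weight_pairs m. case p of (a, b) \<Rightarrow> qterm i j a b - qterm i (j + 3) a b)
        = (\<Sum>(a, b)\<in>weight_pairs k. q_var ^ (j + 5) * qterm (i + 6) (j + 12) a b)"
      unfolding k
      by (subst sum_weight_pairs_Suc_right) (simp_all add: qterm_0_right qterm_Suc_right[of i j])
    then show ?thesis
      by (simp add: k double_series_def case_prod_unfold sum_subtractf sum_distrib_left
          algebra_simps fps_X_power_mult_nth)
  qed
qed

lemma double_series_nth_0: "double_series i j $ 0 = 1"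
  by (simp add: double_series_def weight_pairs_0 qterm_def qexp_def qpochhammer_def)

text \<open>A summand with \<open>a > 0\<close> has \<open>q\<close>-exponent at least
  \<open>i + 1\<close>; one with \<open>a = 0\<close> has \<open>b > 0\<close>, hence exponent at
  least \<open>j + 5\<close>.\<close>

lemma double_series_nth_eq_0:
  assumes "m > 0" "n \<le> i" "n < j + 5"
  shows "double_series i j $ m $ n = 0"
proof -
  have "qterm i j a b $ n = 0" if "(a, b) \<in> weight_pairs m" for a b
  proof -
    have "n < qexp a b + i * a + j * b"
    proof (cases a)
      case 0
      with that assms(1) obtain b' where "b = Suc b'"
        by (cases b) (auto simp: weight_pairs_def)
      then show ?thesis
        using qexp_ge[of a b] assms(3) by simp
    next
      case (Suc a')
      then show ?thesis
        using qexp_ge[of a b] assms(2) by simp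
    qed
    then show ?thesis
      by (simp add: qterm_def mult.assoc fps_X_power_mult_nth)
  qed
  then show ?thesis
    by (auto simp: double_series_def fps_sum_nth intro!: sum.neutral)
qed

section \<open>Recurrences along the three residue classes\<close>

lemma double_series_rec_1:
  "double_series (3 * t) (6 * t) = double_series (3 * t + 1) (6 * t + 3)
     + x_var * (fps_const (q_var ^ (3 * t + 1)) * double_series (3 * t + 3) (6 * t + 6))"
proof -
  define c where "c = fps_const (q_var ^ (3 * t + 1) :: rat fps)"
  define c' where "c' = fps_const (q_var ^ (3 * t + 4) :: rat fps)"
  have cc': "fps_const (q_var ^ (6 * t + 5)) = c * c'"
    unfolding c_def c'_def fps_const_mult power_add[symmetric] by (simp add: add_ac)
  \<comment> \<open>A left shift followed by a right shift reaches the wanted first series. The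
    surplus \<open>x^2\<close> term of the right shift is absorbed by a left shift read backwards,
    which turns \<open>(3t + 4, 6t + 6)\<close> into \<open>(3t + 3, 6t + 6)\<close>.\<close>
  have "double_series (3 * t) (6 * t)
      = double_series (3 * t + 1) (6 * t) + x_var * (c * double_series (3 * t + 4) (6 * t + 6))"
    using double_series_shift_left[of "3 * t" "6 * t"] by (simp add: c_def add_ac)
  moreover have "double_series (3 * t + 3) (6 * t + 6)
      = double_series (3 * t + 4) (6 * t + 6)
        + x_var * (c' * double_series (3 * t + 7) (6 * t + 12))"
    using double_series_shift_left[of "3 * t + 3" "6 * t + 6"]
    by (simp add: c'_def add_ac)
  moreover have "double_series (3 * t + 1) (6 * t)
      = double_series (3 * t + 1) (6 * t + 3)
        + x_var ^ 2 * (c * c' * double_series (3 * t + 7) (6 * t + 12))"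
    using double_series_shift_right[of "3 * t + 1" "6 * t"] unfolding cc' by (simp add: add_ac)
  ultimately show ?thesis
    unfolding c_def[symmetric] by (simp add: algebra_simps power2_eq_square)
qed

lemma double_series_rec_2:
  "double_series (3 * t + 1) (6 * t + 3) = double_series (3 * t + 2) (6 * t + 3)
     + x_var * (fps_const (q_var ^ (3 * t + 2)) * double_series (3 * t + 5) (6 * t + 9))"
  using double_series_shift_left[of "3 * t + 1" "6 * t + 3"] by (simp add: add_ac)

lemma double_series_rec_3:
  "double_series (3 * t + 2) (6 * t + 3) = double_series (3 * t + 3) (6 * t + 6)
     + x_var * (fps_const (q_var ^ (3 * t + 3)) * double_series (3 * t + 6) (6 * t + 12))
     + x_var ^ 2 * (fps_const (q_var ^ (6 * t + 8)) * double_series (3 * t + 8) (6 * t + 15))"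
proof -
  define c where "c = fps_const (q_var ^ (3 * t + 3) :: rat fps)"
  define c' where "c' = fps_const (q_var ^ (3 * t + 5) :: rat fps)"
  define c'' where "c'' = fps_const (q_var ^ (3 * t + 9) :: rat fps)"
  have cc': "fps_const (q_var ^ (6 * t + 8)) = c * c'"
    unfolding c_def c'_def fps_const_mult power_add[symmetric] by (simp add: add_ac)
  have cc'': "fps_const (q_var ^ (6 * t + 14)) = c' * c''"
    unfolding c'_def c''_def fps_const_mult power_add[symmetric] by (simp add: add_ac)
  \<comment> \<open>After one left shift, both resulting series are shifted right. The two surplus
    terms, in \<open>x^2\<close> and \<open>x^3\<close>, are together the left shift of the series
    at \<open>(3t + 8, 6t + 15)\<close>.\<close>
  have "double_series (3 * t + 2) (6 * t + 3)
      = double_series (3 * t + 3) (6 * t + 3) + x_var * (c * double_series (3 * t + 6) (6 * t + 9))"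
    using double_series_shift_left[of "3 * t + 2" "6 * t + 3"]
    by (simp add: c_def add_ac del: add_2_eq_Suc add_2_eq_Suc')
  moreover have "double_series (3 * t + 3) (6 * t + 3)
      = double_series (3 * t + 3) (6 * t + 6)
        + x_var ^ 2 * (c * c' * double_series (3 * t + 9) (6 * t + 15))"
    using double_series_shift_right[of "3 * t + 3" "6 * t + 3"]
    unfolding cc'[symmetric] by (simp add: add_ac)
  moreover have "double_series (3 * t + 6) (6 * t + 9)
      = double_series (3 * t + 6) (6 * t + 12)
        + x_var ^ 2 * (c' * c'' * double_series (3 * t + 12) (6 * t + 21))"
    using double_series_shift_right[of "3 * t + 6" "6 * t + 9"]
    unfolding cc''[symmetric] by (simp add: add_ac)
  moreover have "double_series (3 * t + 8) (6 * t + 15)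
      = double_series (3 * t + 9) (6 * t + 15)
        + x_var * (c'' * double_series (3 * t + 12) (6 * t + 21))"
    using double_series_shift_left[of "3 * t + 8" "6 * t + 15"]
    by (simp add: c''_def add_ac)
  ultimately show ?thesis
    unfolding c_def[symmetric] cc' by (simp add: algebra_simps power2_eq_square)
qed

section \<open>Generating functions of sets of lists\<close>

definition list_gf :: "nat list set \<Rightarrow> rat fps fps" where
  "list_gf A = Abs_fps (\<lambda>m. Abs_fps (\<lambda>n. of_nat (card {l \<in> A. length l = m \<and> sum_list l = n})))"

text \<open>Zero entries are allowed here, so it is the fixed length that ensures finiteness.
  Additivity of \<open>card\<close> on disjoint unions relies on it.\<close>

lemma finite_lists_length_sum: "finite {l \<in> A. length l = m \<and> sum_list l = (n :: nat)}"
proof (rule finite_subset[OF _ finite_lists_length_eq[of "{..n}" m]])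
  show "{l \<in> A. length l = m \<and> sum_list l = n} \<subseteq> {l. set l \<subseteq> {..n} \<and> length l = m}"
    by (auto simp: member_le_sum_list)
qed simp

lemma list_gf_Un:
  assumes "A \<inter> B = {}"
  shows "list_gf (A \<union> B) = list_gf A + list_gf B"
proof -
  have "card {l \<in> A \<union> B. length l = m \<and> sum_list l = n}
      = card {l \<in> A. length l = m \<and> sum_list l = n} + card {l \<in> B. length l = m \<and> sum_list l = n}"
    for m n
  proof (subst card_Un_disjoint[symmetric])
    show "{l \<in> A. length l = m \<and> sum_list l = n} \<inter> {l \<in> B. length l = m \<and> sum_list l = n} = {}"
      using assms by auto
  qed (auto intro: finite_lists_length_sum arg_cong[of _ _ card])
  then show ?thesis
    by (simp add: list_gf_def fps_eq_iff)
qed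

lemma list_gf_Cons:
  "list_gf ((#) k ` A) = x_var * (fps_const (q_var ^ k) * list_gf A)"
proof (intro fps_ext)
  fix m n
  show "list_gf ((#) k ` A) $ m $ n = (x_var * (fps_const (q_var ^ k) * list_gf A)) $ m $ n"
  \<comment> \<open>In the excluded cases \<open>m - 1\<close> or \<open>n - k\<close> below would
    truncate; there both coefficients are 0.\<close>
  proof (cases "m = 0 \<or> n < k")
    case True
    then have "{l \<in> (#) k ` A. length l = m \<and> sum_list l = n} = {}"
      by auto
    with True show ?thesis
      by (auto simp: list_gf_def fps_X_power_mult_nth simp del: Collect_empty_eq)
  next
    case False
    then have "{l \<in> (#) k ` A. length l = m \<and> sum_list l = n}
        = (#) k ` {l \<in> A. length l = m - 1 \<and> sum_list l = n - k}"
      by auto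
    then have "card {l \<in> (#) k ` A. length l = m \<and> sum_list l = n}
        = card {l \<in> A. length l = m - 1 \<and> sum_list l = n - k}"
      by (simp add: card_image)
    with False show ?thesis
      by (simp add: list_gf_def fps_X_power_mult_nth)
  qed
qed

section \<open>Admissible partitions and their recurrences\<close>

definition gap :: "nat \<Rightarrow> nat \<Rightarrow> bool" where
  "gap a b \<longleftrightarrow> a + 2 \<le> b \<and> ((a + b) mod 3 = 2 \<or> a + 4 \<le> b)"

text \<open>As \<open>gap\<close> forces increasing entries, bounding the head bounds all parts;
  \<open>k = 1\<close> encodes positivity. The empty list belongs to every
  \<open>gap_lists k\<close>.\<close>

definition gap_lists :: "nat \<Rightarrow> nat list set" where
  "gap_lists k = {l. successively gap l \<and> (l = [] \<or> k \<le> hd l)}"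

lemma successively_gap_imp_sorted: "successively gap l \<Longrightarrow> sorted l"
proof -
  assume "successively gap l"
  then have "successively (\<le>) l"
    by (rule successively_mono) (auto simp: gap_def)
  then show "sorted l"
    by (simp add: successively_conv_sorted_wrt transp_on_def)
qed

lemma cp12_eq_card_gap_lists:
  "cp12 n m = card {l \<in> gap_lists 1. length l = m \<and> sum_list l = n}"
proof -
  have "partition_into n m l \<and> cp12_condition l
      \<longleftrightarrow> l \<in> gap_lists 1 \<and> length l = m \<and> sum_list l = n" (is "?L \<longleftrightarrow> ?R") for l
  proof
    assume ?L
    moreover from this have "successively gap l"
      by (fastforce simp: successively_conv_nth gap_def cp12_condition_def cong_def
          partition_into_def sorted_iff_nth_Suc)
    ultimately show ?R
      by (cases l) (auto simp: gap_lists_def partition_into_def)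
  next
    assume r: ?R
    then have "sorted l"
      by (simp add: gap_lists_def successively_gap_imp_sorted)
    with r have "partition_into n m l"
      by (cases l) (auto simp: gap_lists_def partition_into_def)
    moreover have "cp12_condition l"
      using r by (fastforce simp: gap_lists_def successively_conv_nth gap_def cp12_condition_def
          cong_def)
    ultimately show ?L
      by simp
  qed
  then show ?thesis
    by (simp add: cp12_def)
qed

text \<open>The tail is bounded below by \<open>gap a (hd l)\<close> already, so its membership is
  stated with the trivial bound 0.\<close>

lemma Cons_in_gap_lists:
  "a # l \<in> gap_lists k \<longleftrightarrow> k \<le> a \<and> (l = [] \<or> gap a (hd l) \<and> l \<in> gap_lists 0)"
  by (auto simp: gap_lists_def successively_Cons)

lemma gap_lists_split: "gap_lists k = gap_lists (Suc k) \<union> (#) k ` {l. k # l \<in> gap_lists k}"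
proof (rule set_eqI)
  fix l
  show "l \<in> gap_lists k \<longleftrightarrow> l \<in> gap_lists (Suc k) \<union> (#) k ` {l. k # l \<in> gap_lists k}"
  proof (cases l)
    case (Cons a l')
    then show ?thesis
      by (cases "a = k") (auto simp: gap_lists_def)
  qed (simp add: gap_lists_def)
qed

lemma list_gf_gap_lists_split:
  "list_gf (gap_lists k) = list_gf (gap_lists (Suc k))
     + x_var * (fps_const (q_var ^ k) * list_gf {l. k # l \<in> gap_lists k})"
  by (subst gap_lists_split, subst list_gf_Un) (auto simp: list_gf_Cons gap_lists_def)

text \<open>A difference \<open>d\<close> of 2 or 3 is allowed only if \<open>2k + d\<close> is 2
  modulo 3. This admits \<open>d = 3\<close> for \<open>k\<close> congruent to 1, neither for 2, and
  \<open>d = 2\<close> for 0, as this and the next two lemmas record.\<close>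

lemma gap_iff_mod_3_eq_1: "k mod 3 = 1 \<Longrightarrow> gap k h \<longleftrightarrow> k + 3 \<le> h"
  unfolding gap_def by presburger

lemma gap_iff_mod_3_eq_2: "k mod 3 = 2 \<Longrightarrow> gap k h \<longleftrightarrow> k + 4 \<le> h"
  unfolding gap_def by presburger

lemma gap_iff_mod_3_eq_0: "k mod 3 = 0 \<Longrightarrow> gap k h \<longleftrightarrow> h = k + 2 \<or> k + 4 \<le> h"
  unfolding gap_def by presburger

lemma list_gf_gap_lists_rec_1:
  assumes "k mod 3 = 1"
  shows "list_gf (gap_lists k) = list_gf (gap_lists (Suc k))
     + x_var * (fps_const (q_var ^ k) * list_gf (gap_lists (k + 3)))"
proof -
  have "{l. k # l \<in> gap_lists k} = gap_lists (k + 3)"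
    using assms by (auto simp: Cons_in_gap_lists gap_iff_mod_3_eq_1) (auto simp: gap_lists_def)
  then show ?thesis
    using list_gf_gap_lists_split[of k] by simp
qed

lemma list_gf_gap_lists_rec_2:
  assumes "k mod 3 = 2"
  shows "list_gf (gap_lists k) = list_gf (gap_lists (Suc k))
     + x_var * (fps_const (q_var ^ k) * list_gf (gap_lists (k + 4)))"
proof -
  have "{l. k # l \<in> gap_lists k} = gap_lists (k + 4)"
    using assms by (auto simp: Cons_in_gap_lists gap_iff_mod_3_eq_2) (auto simp: gap_lists_def)
  then show ?thesis
    using list_gf_gap_lists_split[of k] by simp
qed

lemma list_gf_gap_lists_rec_3:
  assumes "k mod 3 = 0"
  shows "list_gf (gap_lists k) = list_gf (gap_lists (Suc k))
     + x_var * (fps_const (q_var ^ k) * list_gf (gap_lists (k + 4)))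
     + x_var ^ 2 * (fps_const (q_var ^ (2 * k + 2)) * list_gf (gap_lists (k + 6)))"
proof -
  have k2: "(k + 2) mod 3 = 2"
    using assms by presburger
  \<comment> \<open>Either the next part is at least \<open>k + 4\<close>, or it is
    \<open>k + 2\<close>. The latter is 2 modulo 3, so any part after it is at least
    \<open>k + 6\<close>; the prefix \<open>k, k + 2\<close> accounts for
    \<open>x^2 q^(2k+2)\<close>.\<close>
  have "{l. k # l \<in> gap_lists k} = gap_lists (k + 4) \<union> (#) (k + 2) ` gap_lists (k + 6)"
  proof (rule set_eqI)
    fix l
    show "l \<in> {l. k # l \<in> gap_lists k}
        \<longleftrightarrow> l \<in> gap_lists (k + 4) \<union> (#) (k + 2) ` gap_lists (k + 6)"
    proof (cases l)
      case Nil
      then show ?thesis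
        by (simp add: gap_lists_def)
    next
      case (Cons h l')
      have "(k + 2) # l' \<in> gap_lists 0 \<longleftrightarrow> l' \<in> gap_lists (k + 6)"
        using k2 by (auto simp: Cons_in_gap_lists gap_iff_mod_3_eq_2) (auto simp: gap_lists_def)
      then show ?thesis
        using assms Cons
        by (auto simp: Cons_in_gap_lists[of k] gap_iff_mod_3_eq_0) (auto simp: gap_lists_def)
    qed
  qed
  moreover have "gap_lists (k + 4) \<inter> (#) (k + 2) ` gap_lists (k + 6) = {}"
    by (auto simp: gap_lists_def)
  ultimately have "list_gf {l. k # l \<in> gap_lists k}
      = list_gf (gap_lists (k + 4))
        + x_var * (fps_const (q_var ^ (k + 2)) * list_gf (gap_lists (k + 6)))"
    by (simp add: list_gf_Un list_gf_Cons)
  moreover have "fps_const (q_var ^ (2 * k + 2) :: rat fps)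
      = fps_const (q_var ^ k) * fps_const (q_var ^ (k + 2))"
    unfolding fps_const_mult power_add[symmetric] by (simp add: add_ac mult_2)
  ultimately show ?thesis
    using list_gf_gap_lists_split[of k] by (simp add: algebra_simps power2_eq_square)
qed

lemma list_gf_gap_lists_nth_0: "list_gf (gap_lists k) $ 0 = 1"
proof -
  have "{l \<in> gap_lists k. length l = 0 \<and> sum_list l = n} = (if n = 0 then {[]} else {})" for n
    by (auto simp: gap_lists_def)
  then show ?thesis
    by (simp add: list_gf_def fps_eq_iff)
qed

lemma list_gf_gap_lists_nth_eq_0:
  assumes "m > 0" "n < k"
  shows "list_gf (gap_lists k) $ m $ n = 0"
proof -
  have "k \<le> sum_list l" if "l \<in> gap_lists k" "length l = m" for l
    using that assms(1) by (cases l) (auto simp: gap_lists_def)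
  with assms(2) have "{l \<in> gap_lists k. length l = m \<and> sum_list l = n} = {}"
    by (fastforce simp flip: not_le)
  then show ?thesis
    by (simp add: list_gf_def del: Collect_empty_eq)
qed

section \<open>Uniqueness of solutions of the recurrences\<close>

text \<open>The recurrence raises \<open>k\<close> at the same power of \<open>x\<close> or lowers the power of \<open>x\<close>, so a
  coefficient can be pushed to an index \<open>k\<close> beyond its power of \<open>q\<close>.\<close>

lemma series_family_eq_0:
  fixes d :: "nat \<Rightarrow> 'a::comm_ring_1 fps fps"
  assumes rec: "\<And>k. k > 0 \<Longrightarrow>
      \<exists>p r s. d k = d (Suc k) + fps_X * (r * d (k + p)) + fps_X ^ 2 * (s * d (k + 6))"
    and nth_0: "\<And>k. d k $ 0 = 0"
    and vanish: "\<And>k m n. m > 0 \<Longrightarrow> n < k \<Longrightarrow> d k $ m $ n = 0"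
    and "k > 0"
  shows "d k = 0"
proof -
  have "\<forall>k>0. d k $ m = 0" for m
  proof (induction m rule: less_induct)
    case (less m)
    show ?case
    proof (cases "m = 0")
      case False
      \<comment> \<open>Coefficient \<open>i\<close> of the product involves only coefficients of
        \<open>d k\<close> up to \<open>i\<close>, all zero by induction. This removes every term
        with a factor \<open>x\<close>.\<close>
      have low: "(r * d k) $ i = 0" if "i < m" "k > 0" for r k i
        using less that by (auto simp: fps_mult_nth intro!: sum.neutral)
      have step: "d k $ m = d (Suc k) $ m" if k: "k > 0" for k
      proof -
        obtain p r s where
          "d k = d (Suc k) + fps_X * (r * d (k + p)) + fps_X ^ 2 * (s * d (k + 6))"
          using rec[OF k] by blast
        then have "d k $ m = (d (Suc k) + fps_X * (r * d (k + p)) + fps_X ^ 2 * (s * d (k + 6))) $ m"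
          by (rule arg_cong)
        then show ?thesis
          using False k by (simp add: fps_X_power_mult_nth low)
      qed
      have shift: "d k $ m = d (k + t) $ m" if "k > 0" for k t
        proof (induction t)
        case (Suc t)
        then show ?case
          using that step[of "k + t"] by simp
      qed simp
      have "d k $ m $ n = 0" if "k > 0" for k n
        using shift[OF that, of "Suc n"] False by (simp add: vanish)
      then show ?thesis
        by (simp add: fps_eq_iff)
    qed (simp add: nth_0)
  qed
  with \<open>k > 0\<close> show ?thesis
    by (simp add: fps_eq_iff)
qed

section \<open>Identification of the two families\<close>

definition shifted_series :: "nat \<Rightarrow> rat fps fps" where
  "shifted_series k = double_series (k - 1)
     (if k mod 3 = 1 then 2 * k - 2 else if k mod 3 = 2 then 2 * k - 1 else 2 * k - 3)"

lemma shifted_series_eqs: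
  "shifted_series (3 * t + 1) = double_series (3 * t) (6 * t)"
  "shifted_series (3 * t + 2) = double_series (3 * t + 1) (6 * t + 3)"
  "shifted_series (3 * t + 3) = double_series (3 * t + 2) (6 * t + 3)"
proof -
  have "(3 * t + 1) mod 3 = 1" "(3 * t + 2) mod 3 = 2" "(3 * t + 3) mod 3 = 0"
    by presburger+
  then show "shifted_series (3 * t + 1) = double_series (3 * t) (6 * t)"
    "shifted_series (3 * t + 2) = double_series (3 * t + 1) (6 * t + 3)"
    "shifted_series (3 * t + 3) = double_series (3 * t + 2) (6 * t + 3)"
    by (simp_all add: shifted_series_def) (rule arg_cong2[of _ _ _ _ double_series]; simp)+
qed

text \<open>Both families satisfy the same linear recurrences, so their difference does too and
  vanishes by \<open>series_family_eq_0\<close>.\<close>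

lemma list_gf_gap_lists_eq:
  assumes "k > 0"
  shows "list_gf (gap_lists k) = shifted_series k"
proof -
  define d where "d k = list_gf (gap_lists k) - shifted_series k" for k
  have "d k = 0"
  proof (rule series_family_eq_0[OF _ _ _ assms])
    fix k :: nat assume "k > 0"
    define t where "t = (k - 1) div 3"
    consider "k = 3 * t + 1" | "k = 3 * t + 2" | "k = 3 * t + 3"
      using \<open>k > 0\<close> unfolding t_def by linarith
    then show "\<exists>p r s. d k = d (Suc k) + x_var * (r * d (k + p)) + x_var ^ 2 * (s * d (k + 6))"
    proof cases
      case 1
      then have "k mod 3 = 1"
        by presburger
      have "d k = d (Suc k) + x_var * (fps_const (q_var ^ k) * d (k + 3))
          + x_var ^ 2 * (0 * d (k + 6))"
        using list_gf_gap_lists_rec_1[OF \<open>k mod 3 = 1\<close>] double_series_rec_1[of t]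
          shifted_series_eqs[of t] shifted_series_eqs[of "Suc t"]
        by (simp add: 1 d_def algebra_simps)
      then show ?thesis
        by blast
    next
      case 2
      then have "k mod 3 = 2"
        by presburger
      have suc: "3 * t + 3 = Suc (Suc (Suc (3 * t)))"
        by simp
      have "d k = d (Suc k) + x_var * (fps_const (q_var ^ k) * d (k + 4))
          + x_var ^ 2 * (0 * d (k + 6))"
        using list_gf_gap_lists_rec_2[OF \<open>k mod 3 = 2\<close>] double_series_rec_2[of t]
          shifted_series_eqs(2)[of t] shifted_series_eqs(3)[of t, unfolded suc]
          shifted_series_eqs(3)[of "Suc t"]
        by (simp add: 2 d_def algebra_simps)
      then show ?thesis
        by blast
    next
      case 3
      then have "k mod 3 = 0"
        by presburger
      \<comment> \<open>For \<open>k = 3t + 3\<close>, the indices \<open>k + 4\<close> and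
        \<open>k + 6\<close> are \<open>3(t + 2) + 1\<close> and \<open>3(t + 2) + 3\<close>, hence
        the instance at \<open>t + 2\<close>.\<close>
      have "d k = d (Suc k) + x_var * (fps_const (q_var ^ k) * d (k + 4))
          + x_var ^ 2 * (fps_const (q_var ^ (2 * k + 2)) * d (k + 6))"
        using list_gf_gap_lists_rec_3[OF \<open>k mod 3 = 0\<close>] double_series_rec_3[of t]
          shifted_series_eqs[of t] shifted_series_eqs[of "Suc t"] shifted_series_eqs[of "t + 2"]
        by (simp add: 3 d_def algebra_simps)
      then show ?thesis
        by blast
    qed
  next
    show "d k $ 0 = 0" for k
      by (simp add: d_def list_gf_gap_lists_nth_0 shifted_series_def double_series_nth_0)
    \<comment> \<open>Here \<open>n < k\<close> means that \<open>n\<close> is at most the first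
      index \<open>k - 1\<close>, and the second index is at least \<open>2k - 3\<close>, so adding
      5 exceeds \<open>n\<close>.\<close>
    show "d k $ m $ n = 0" if "m > 0" "n < k" for k m n
      using that by (auto simp: d_def list_gf_gap_lists_nth_eq_0 shifted_series_def
          intro!: double_series_nth_eq_0)
  qed
  then show ?thesis
    by (simp add: d_def)
qed

section \<open>Convergence of the double sum\<close>

theorem theorem12:
  shows "((\<lambda>(n1 :: nat, n2 :: nat).
             fps_const (q_var ^ (6 * n2\<^sup>2 - n2 + 2 * n1\<^sup>2 - n1 + 6 * n2 * n1) /
                        (qpochhammer q_var q_var n1 * qpochhammer (q_var ^ 3) (q_var ^ 3) n2)) *
             x_var ^ (2 * n2 + n1))
           has_sum Abs_fps (\<lambda>m. Abs_fps (\<lambda>n. of_nat (cp12 n m)))) UNIV"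
    (is "(?f has_sum ?g) UNIV")
proof -
  have g: "?g = double_series 0 0"
    using list_gf_gap_lists_eq[of 1] shifted_series_eqs(1)[of 0]
    by (simp add: list_gf_def cp12_eq_card_gap_lists)
  \<comment> \<open>Both Pochhammer symbols have constant term 1, so the division is multiplication
    by inverses.\<close>
  have f: "?f (a, b) = fps_const (qterm 0 0 a b) * x_var ^ (a + 2 * b)" for a b
    by (simp add: qterm_def qexp_def fps_divide_unit qpochhammer_fps_nth_0 fps_inverse_mult
        mult.assoc add.commute)
  have f_nth: "?f p $ m = (if p \<in> weight_pairs m then (\<lambda>(a, b). qterm 0 0 a b) p else 0)" for p m
  proof (cases p)
    case (Pair a b)
    show ?thesis
      unfolding Pair f by (auto simp: weight_pairs_def fps_X_power_mult_right_nth)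
  qed
  \<comment> \<open>In the \<open>x\<close>-adic topology it suffices that each
    \<open>x\<close>-coefficient of the partial sums is eventually constant; it is so once
    \<open>F\<close> contains the finite set \<open>weight_pairs m\<close>.\<close>
  have "\<forall>\<^sub>F F in finite_subsets_at_top UNIV. (\<Sum>p\<in>F. ?f p) $ m = double_series 0 0 $ m" for m
    unfolding eventually_finite_subsets_at_top
  proof (intro exI[of _ "weight_pairs m"] conjI allI impI)
    fix F :: "(nat \<times> nat) set"
    assume F: "finite F \<and> weight_pairs m \<subseteq> F \<and> F \<subseteq> UNIV"
    then have "(\<Sum>p\<in>F. ?f p) $ m = (\<Sum>p\<in>weight_pairs m. (\<lambda>(a, b). qterm 0 0 a b) p)"
      unfolding fps_sum_nth f_nth
      by (simp add: sum.If_cases Int_absorb1)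
    then show "(\<Sum>p\<in>F. ?f p) $ m = double_series 0 0 $ m"
      by (simp add: double_series_def)
  qed (simp_all add: finite_weight_pairs)
  then show ?thesis
    unfolding g has_sum_def by (rule tendsto_fpsI)
qed

end
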